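(* For every even natural number $k\geq 2$, we have $n(k,2)=k+2$.
   Context: $S_n$ and $A_n$ denote the symmetric and alternating groups on $\{1,\dots,n\}$. For natural numbers $k,l\geq 2$ such that $k$ is even or $l$ is odd, $n(k,l)$ denotes the largest natural number $n$ such that every element of $A_n$ can be written as a product of $k$ many $l$-cycles in $S_n$ (and every such product lies in $A_n$). *)

theory Defs
  imports "HOL-Algebra.Sym_Groups"
begin

text \<open>
  For \<open>l = 1\<close> this set would be \<open>{id}\<close> (if \<open>n > 0\<close>); only \<open>l \<ge> 2\<close> is of interest.
\<close>

definition cycles_of_length :: "nat \<Rightarrow> nat \<Rightarrow> (nat \<Rightarrow> nat) set"
  where "cycles_of_length l n =
    {cycle_of_list cs | cs. cycle cs \<and> length cs = l \<and> set cs \<subseteq> {1..n}}"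

text \<open>Exactly \<open>k\<close> factors, not necessarily distinct or disjoint.\<close>

definition cycle_products :: "nat \<Rightarrow> nat \<Rightarrow> nat \<Rightarrow> (nat \<Rightarrow> nat) set"
  where "cycle_products k l n =
    {foldr (\<otimes>\<^bsub>sym_group n\<^esub>) ps \<one>\<^bsub>sym_group n\<^esub> | ps.
      length ps = k \<and> set ps \<subseteq> cycles_of_length l n}"

lemma evenperm_cycle_of_list:
  assumes "cycle cs" "cs \<noteq> []"
  shows "evenperm (cycle_of_list cs) \<longleftrightarrow> odd (length cs)"
  using assms
proof (induction cs rule: cycle_of_list.induct)
  case (1 i j cs)
  have "evenperm (cycle_of_list (i # j # cs)) \<longleftrightarrow>
      (evenperm (transpose i j) \<longleftrightarrow> evenperm (cycle_of_list (j # cs)))"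
    unfolding cycle_of_list.simps
    by (rule evenperm_comp[OF permutation_swap_id permutation_of_cycle])
  with 1 show ?case
    by (simp add: evenperm_swap del: cycle_of_list.simps)
qed auto

lemma cycle_products_subset_alt_group:
  assumes "l \<ge> 2" and "even k \<or> odd l"
  shows "cycle_products k l n \<subseteq> carrier (alt_group n)"
proof -
  have "foldr (\<circ>) ps id permutes {1..n} \<and>
      (evenperm (foldr (\<circ>) ps id) \<longleftrightarrow> even (length ps) \<or> odd l)"
    if "set ps \<subseteq> cycles_of_length l n" for ps
    using that
  proof (induction ps)
    case (Cons p ps)
    then obtain cs where cs: "p = cycle_of_list cs" "cycle cs" "length cs = l" "set cs \<subseteq> {1..n}"
      by (auto simp: cycles_of_length_def)
    from cs have p: "p permutes {1..n}"
      using cycle_permutes permutes_subset by blast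
    have "evenperm p \<longleftrightarrow> odd l"
      using evenperm_cycle_of_list[of cs] cs assms(1) by force
    let ?q = "foldr (\<circ>) ps id"
    have q: "?q permutes {1..n}" "evenperm ?q \<longleftrightarrow> even (length ps) \<or> odd l"
      using Cons.IH Cons.prems unfolding list.set by blast+
    have "p \<circ> ?q permutes {1..n}"
      by (rule permutes_compose[OF q(1) p])
    moreover have "evenperm (p \<circ> ?q) \<longleftrightarrow> (evenperm p \<longleftrightarrow> evenperm ?q)"
      using p q(1) by (intro evenperm_comp) (auto simp: permutation_permutes)
    moreover have "foldr (\<circ>) (p # ps) id = p \<circ> ?q"
      by simp
    moreover have "even (length (p # ps)) \<longleftrightarrow> odd (length ps)"
      by simp
    ultimately show ?case
      using q(2) \<open>evenperm p \<longleftrightarrow> odd l\<close> by metis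
  qed (auto simp: permutes_id)
  with assms(2) show ?thesis
    by (fastforce simp: cycle_products_def alt_group_carrier sym_group_mult sym_group_one)
qed

text \<open>
  \<open>max_degree k l\<close> is the number \<open>n(k, l)\<close>; the parameters are meant to satisfy
  \<open>k \<ge> 2\<close>, \<open>l \<ge> 2\<close> and \<open>even k \<or> odd l\<close>. The degrees \<open>n\<close> with the stated property need not form
  an initial segment: for \<open>n < l\<close> there are no \<open>l\<close>-cycles, so not even the identity is a product.
\<close>

definition max_degree :: "nat \<Rightarrow> nat \<Rightarrow> nat"
  where "max_degree k l =
    (GREATEST n. \<forall>p \<in> carrier (alt_group n). p \<in> cycle_products k l n)"

end

theory Submission
  imports Defs
begin

text \<open>
  Counting transpositions gives both bounds.

  A permutation of \<open>m > 0\<close> points is a product of at most \<open>m - 1\<close> transpositions, since one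
  transposition repairs the image of one point and the last point needs no repair
  (\<open>permutation_product_of_few_transpositions\<close>). For \<open>m = k + 2\<close> this gives at most \<open>k + 1\<close> factors.
  As \<open>k + 1\<close> is odd, an even permutation cannot use all of them, so it needs at most \<open>k\<close>, and an even
  number of factors is missing. Repeating one fixed transposition fills them up to exactly \<open>k\<close>
  (\<open>even_permutation_product_of_transpositions\<close>).

  Conversely, regard the factors of a product of \<open>k\<close> transpositions as the edges of a graph. The
  product maps each connected component to itself, and \<open>k\<close> edges merge any set of \<open>m\<close> vertices into
  no fewer than \<open>m - k\<close> components (\<open>transpositions_invariant_labelling\<close>). A \<open>(k + 3)\<close>-cycle is
  transitive on its support, hence needs at least \<open>k + 2\<close> transpositions. It is even because \<open>k + 3\<close>
  is odd, and it exists in every degree \<open>n \<ge> k + 3\<close>, so no such degree has the required property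
  (\<open>long_cycle_not_product_of_transpositions\<close>).
\<close>

section \<open>Products of transpositions\<close>

definition transpositions_on :: "'a set \<Rightarrow> ('a \<Rightarrow> 'a) set"
  where "transpositions_on A = {transpose a b | a b. a \<in> A \<and> b \<in> A \<and> a \<noteq> b}"

lemma transpositions_on_mono: "A \<subseteq> B \<Longrightarrow> transpositions_on A \<subseteq> transpositions_on B"
  by (auto simp: transpositions_on_def)

lemma cycles_of_length_2: "cycles_of_length 2 n = transpositions_on {1..n}"
proof
  show "cycles_of_length 2 n \<subseteq> transpositions_on {1..n}"
  proof
    fix p assume "p \<in> cycles_of_length 2 n"
    then obtain cs where cs: "p = cycle_of_list cs" "cycle cs" "length cs = 2" "set cs \<subseteq> {1..n}"
      by (auto simp: cycles_of_length_def)
    then obtain a b where ab: "cs = [a, b]"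
      by (auto simp: numeral_2_eq_2 length_Suc_conv)
    have "p = transpose a b" "a \<in> {1..n}" "b \<in> {1..n}" "a \<noteq> b"
      using cs ab by auto
    then show "p \<in> transpositions_on {1..n}"
      unfolding transpositions_on_def by blast
  qed
  show "transpositions_on {1..n} \<subseteq> cycles_of_length 2 n"
  proof
    fix p assume "p \<in> transpositions_on {1..n}"
    then obtain a b where ab: "p = transpose a b" "a \<in> {1..n}" "b \<in> {1..n}" "a \<noteq> b"
      unfolding transpositions_on_def by blast
    then have "p = cycle_of_list [a, b] \<and> cycle [a, b] \<and> length [a, b] = 2 \<and> set [a, b] \<subseteq> {1..n}"
      by auto
    then show "p \<in> cycles_of_length 2 n"
      unfolding cycles_of_length_def by blast
  qed
qed

lemma cycle_products_2:
  "cycle_products k 2 n =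
    {foldr (\<circ>) ps id | ps. length ps = k \<and> set ps \<subseteq> transpositions_on {1..n}}"
  by (simp add: cycle_products_def cycles_of_length_2 sym_group_mult sym_group_one)

lemma swapidseq_product_of_transpositions:
  assumes "set ps \<subseteq> transpositions_on A"
  shows "swapidseq (length ps) (foldr (\<circ>) ps id)"
  using assms
proof (induction ps)
  case (Cons p ps)
  then obtain a b where p: "p = transpose a b" "a \<noteq> b"
    by (auto simp: transpositions_on_def)
  have "swapidseq (length ps) (foldr (\<circ>) ps id)"
    using Cons unfolding list.set by blast
  from comp_Suc[OF this p(2)] show ?case
    unfolding p(1) foldr.simps comp_apply list.size add_Suc_right add_0_right .
qed simp

lemma evenperm_product_of_transpositions:
  assumes "set ps \<subseteq> transpositions_on A"
  shows "evenperm (foldr (\<circ>) ps id) \<longleftrightarrow> even (length ps)"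
  using swapidseq_product_of_transpositions[OF assms] by (rule evenperm_unique) simp

section \<open>Few transpositions suffice\<close>

text \<open>
  Composing with \<open>transpose x (p x)\<close> turns \<open>p\<close> into a permutation that fixes \<open>x\<close>, so each point
  beyond the first costs at most one factor.
\<close>

lemma permutation_product_of_few_transpositions:
  assumes "finite A" "A \<noteq> {}" "p permutes A"
  shows "\<exists>ps. set ps \<subseteq> transpositions_on A \<and> length ps < card A \<and> p = foldr (\<circ>) ps id"
  using assms
proof (induction A arbitrary: p rule: finite_ne_induct)
  case (singleton x)
  then have "p = foldr (\<circ>) [] id"
    by simp
  then show ?case
    by (intro exI[of _ "[]"]) simp
next
  case (insert x A)
  have mono: "transpositions_on A \<subseteq> transpositions_on (insert x A)"
    by (rule transpositions_on_mono) blast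
  define q where "q = transpose x (p x) \<circ> p"
  have "q permutes A"
    unfolding q_def using insert.prems by (rule permutes_insert_lemma)
  then obtain qs where qs: "set qs \<subseteq> transpositions_on A" "length qs < card A"
      "q = foldr (\<circ>) qs id"
    using insert.IH by blast
  have p: "p = transpose x (p x) \<circ> q"
    by (simp add: q_def fun_eq_iff)
  show ?case
  proof (cases "p x = x")
    case True
    with p have "p = q"
      by simp
    with qs(3) have "p = foldr (\<circ>) qs id"
      by simp
    moreover have "length qs < card (insert x A)"
      using qs(2) insert.hyps by simp
    ultimately show ?thesis
      using order_trans[OF qs(1) mono] by (intro exI[of _ qs] conjI)
  next
    case False
    have "p x \<in> insert x A"
      using permutes_in_image[OF insert.prems] by blast
    moreover have "x \<noteq> p x"
      using False by simp
    ultimately have "transpose x (p x) \<in> transpositions_on (insert x A)"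
      unfolding transpositions_on_def by blast
    then have "set (transpose x (p x) # qs) \<subseteq> transpositions_on (insert x A)"
      using qs(1) mono by auto
    moreover have "p = foldr (\<circ>) (transpose x (p x) # qs) id"
      using p qs(3) by simp
    moreover have "length (transpose x (p x) # qs) < card (insert x A)"
      using qs(2) insert.hyps by simp
    ultimately show ?thesis
      by (intro exI[of _ "transpose x (p x) # qs"] conjI)
  qed
qed

lemma product_of_transpositions_pad:
  assumes "set ps \<subseteq> transpositions_on A" "t \<in> transpositions_on A"
  shows "\<exists>qs. set qs \<subseteq> transpositions_on A \<and> length qs = length ps + 2 * d \<and>
    foldr (\<circ>) qs id = foldr (\<circ>) ps id"
proof (induction d)
  case 0
  with assms show ?case
    by auto
next
  case (Suc d)
  then obtain qs where qs: "set qs \<subseteq> transpositions_on A" "length qs = length ps + 2 * d"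
      "foldr (\<circ>) qs id = foldr (\<circ>) ps id"
    by blast
  have "t \<circ> (t \<circ> foldr (\<circ>) qs id) = foldr (\<circ>) qs id"
    using assms(2) by (auto simp: transpositions_on_def fun_eq_iff)
  then have "foldr (\<circ>) (t # t # qs) id = foldr (\<circ>) ps id"
    using qs(3) by simp
  moreover have "set (t # t # qs) \<subseteq> transpositions_on A"
      "length (t # t # qs) = length ps + 2 * Suc d"
    using qs(1,2) assms(2) by simp_all
  ultimately show ?case
    by (intro exI[of _ "t # t # qs"] conjI)
qed

text \<open>
  Parity saves one transposition: \<open>card A - 1\<close> is odd here, and an even permutation has only
  factorisations of even length.
\<close>

lemma even_permutation_product_of_transpositions:
  assumes "finite A" "card A = k + 2" "even k" "p permutes A" "evenperm p"
  shows "\<exists>ps. set ps \<subseteq> transpositions_on A \<and> length ps = k \<and> p = foldr (\<circ>) ps id"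
proof -
  have "A \<noteq> {}"
    using assms(2) by auto
  then obtain ps where ps: "set ps \<subseteq> transpositions_on A" "length ps < card A"
      "p = foldr (\<circ>) ps id"
    using permutation_product_of_few_transpositions[OF assms(1) _ assms(4)] by blast
  have "even (length ps)"
    using evenperm_product_of_transpositions[OF ps(1)] ps(3) assms(5) by simp
  then have "length ps \<noteq> k + 1"
    using assms(3) by auto
  with ps(2) assms(2) have "length ps \<le> k"
    by linarith
  have "even (k - length ps)"
    using \<open>even (length ps)\<close> assms(3) by simp
  then obtain d where "k - length ps = 2 * d"
    by (rule evenE)
  with \<open>length ps \<le> k\<close> have d: "length ps + 2 * d = k"
    by linarith
  have "\<not> card A \<le> Suc 0"
    using assms(2) by simp
  then obtain a b where "a \<in> A" "b \<in> A" "a \<noteq> b"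
    using card_le_Suc0_iff_eq[OF assms(1)] by blast
  then have "transpose a b \<in> transpositions_on A"
    unfolding transpositions_on_def by blast
  from product_of_transpositions_pad[OF ps(1) this, of d] show ?thesis
    unfolding d ps(3)[symmetric] by (simp only: eq_commute[of p])
qed

section \<open>Long cycles need many transpositions\<close>

text \<open>
  The label of a point names its connected component in the graph whose edges are the pairs swapped
  by the factors. Adding an edge \<open>{a, b}\<close> relabels the component of \<open>b\<close> with the label of \<open>a\<close>, so at
  most one label is lost per factor. The set \<open>S\<close> may be smaller than the support of the factors:
  edges that leave \<open>S\<close> cost no more.
\<close>

lemma transpositions_invariant_labelling:
  assumes "set ps \<subseteq> transpositions_on A" "finite S"
  shows "\<exists>f :: 'a \<Rightarrow> 'a. f \<circ> foldr (\<circ>) ps id = f \<and> card S \<le> card (f ` S) + length ps"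
proof -
  have "\<exists>f :: 'a \<Rightarrow> 'a. (\<forall>p \<in> set ps. f \<circ> p = f) \<and> card S \<le> card (f ` S) + length ps"
    using assms(1)
  proof (induction ps)
    case Nil
    show ?case
      by (intro exI[of _ id]) simp
  next
    case (Cons p ps)
    then obtain f :: "'a \<Rightarrow> 'a" where f: "\<forall>q \<in> set ps. f \<circ> q = f"
        "card S \<le> card (f ` S) + length ps"
      unfolding list.set by blast
    obtain a b where p: "p = transpose a b"
      using Cons.prems by (auto simp: transpositions_on_def)
    define g where "g x = (if f x = f b then f a else f x)" for x
    have "g \<circ> q = g" if "q \<in> set ps" for q
    proof
      fix x
      have "f \<circ> q = f"
        using f(1) that by blast
      from fun_cong[OF this, of x] have "f (q x) = f x"
        by simp
      then show "(g \<circ> q) x = g x"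
        by (simp add: g_def)
    qed
    moreover have "g \<circ> p = g"
      by (auto simp: p g_def fun_eq_iff transpose_def)
    moreover have "card (f ` S) \<le> card (g ` S) + 1"
    proof -
      have "f ` S \<subseteq> insert (f b) (g ` S)"
        by (auto simp: g_def)
      then have "card (f ` S) \<le> card (insert (f b) (g ` S))"
        using assms(2) by (intro card_mono) auto
      also have "\<dots> \<le> card (g ` S) + 1"
        using card_insert_le_m1[of "card (g ` S) + 1" "g ` S" "f b"] by simp
      finally show ?thesis .
    qed
    moreover have "card S \<le> card (g ` S) + length (p # ps)"
      if "card (f ` S) \<le> card (g ` S) + 1"
      using f(2) that by simp
    ultimately show ?case
      unfolding list.set by blast
  qed
  then obtain f :: "'a \<Rightarrow> 'a" where f: "\<forall>p \<in> set ps. f \<circ> p = f"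
      "card S \<le> card (f ` S) + length ps"
    by blast
  have "f \<circ> foldr (\<circ>) ps id = f"
    using f(1) by (induction ps) (simp_all add: comp_assoc[symmetric])
  with f(2) show ?thesis
    by blast
qed

lemma cycle_of_list_nth_Suc:
  assumes "cycle cs" "Suc i < length cs"
  shows "cycle_of_list cs (cs ! i) = cs ! Suc i"
proof -
  have "map (cycle_of_list cs) cs = rotate1 cs"
    using cyclic_rotation[OF assms(1), of 1] by simp
  from arg_cong[OF this, of "\<lambda>xs. xs ! i"] have "cycle_of_list cs (cs ! i) = rotate1 cs ! i"
    using assms(2) by simp
  then show ?thesis
    using assms(2) by (simp add: nth_rotate1)
qed

lemma invariant_labelling_constant_on_cycle:
  assumes "cycle cs" "f \<circ> cycle_of_list cs = f" "i < length cs"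
  shows "f (cs ! i) = f (cs ! 0)"
  using assms(3)
proof (induction i)
  case (Suc i)
  have "f (cs ! Suc i) = f (cycle_of_list cs (cs ! i))"
    using cycle_of_list_nth_Suc[OF assms(1) Suc.prems] by simp
  also have "\<dots> = f (cs ! i)"
    using fun_cong[OF assms(2), of "cs ! i"] by simp
  finally show ?case
    using Suc by simp
qed simp

text \<open>
  An invariant labelling is constant on the support of a cycle, so the labelling of
  \<open>transpositions_invariant_labelling\<close> has lost all but one of the labels there.
\<close>

lemma long_cycle_not_product_of_transpositions:
  fixes cs :: "'a list"
  assumes "cycle cs" "length ps + 1 < length cs" "set ps \<subseteq> transpositions_on A"
  shows "cycle_of_list cs \<noteq> foldr (\<circ>) ps id"
proof
  assume eq: "cycle_of_list cs = foldr (\<circ>) ps id"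
  obtain f :: "'a \<Rightarrow> 'a" where f: "f \<circ> cycle_of_list cs = f"
      "card (set cs) \<le> card (f ` set cs) + length ps"
    using transpositions_invariant_labelling[OF assms(3) finite_set, of cs] unfolding eq by blast
  have "f ` set cs \<subseteq> {f (cs ! 0)}"
    using invariant_labelling_constant_on_cycle[OF assms(1) f(1)] by (auto simp: in_set_conv_nth)
  then have "card (f ` set cs) \<le> 1"
    using card_mono[of "{f (cs ! 0)}" "f ` set cs"] by simp
  moreover have "card (set cs) = length cs"
    using assms(1) by (simp add: distinct_card)
  ultimately show False
    using f(2) assms(2) by linarith
qed

section \<open>The largest degree\<close>

theorem theoremB:
  fixes k :: nat
  assumes "k \<ge> 2" and "even k"
  shows "max_degree k 2 = k + 2"
  unfolding max_degree_def
proof (rule Greatest_equality)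
  show "\<forall>p \<in> carrier (alt_group (k + 2)). p \<in> cycle_products k 2 (k + 2)"
  proof
    fix p assume "p \<in> carrier (alt_group (k + 2))"
    then have "p permutes {1..k + 2}" "evenperm p"
      by (auto simp: alt_group_carrier)
    then show "p \<in> cycle_products k 2 (k + 2)"
      using even_permutation_product_of_transpositions[of "{1..k + 2}" k p] assms(2)
      unfolding cycle_products_2 by auto
  qed
next
  fix n assume n: "\<forall>p \<in> carrier (alt_group n). p \<in> cycle_products k 2 n"
  show "n \<le> k + 2"
  proof (rule ccontr)
    assume "\<not> n \<le> k + 2"
    define cs where "cs = [1..<k + 4]"
    have cs: "cycle cs" "length cs = k + 3" "set cs \<subseteq> {1..n}"
      using \<open>\<not> n \<le> k + 2\<close> by (auto simp: cs_def)
    have "cycle_of_list cs permutes {1..n}"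
      using cycle_permutes cs(3) by (rule permutes_subset)
    moreover have "evenperm (cycle_of_list cs)"
      using evenperm_cycle_of_list[of cs] cs assms(2) by force
    ultimately have "cycle_of_list cs \<in> cycle_products k 2 n"
      using n by (auto simp: alt_group_carrier)
    then obtain ps where "cycle_of_list cs = foldr (\<circ>) ps id" "length ps = k"
        "set ps \<subseteq> transpositions_on {1..n}"
      unfolding cycle_products_2 by blast
    with long_cycle_not_product_of_transpositions[of cs ps "{1..n}"] cs show False
      by simp
  qed
qed

end
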